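(* Let $A\in M_n(H)$ be an $n\times n$ matrix over the commutative quaternions $H$. The following are equivalent: (I) $A$ is invertible; (II) $Ax=0$ has a unique solution $x$ (among $n\times1$ column vectors with entries in $H$); (III) $\det(\eta(A))\neq 0$, i.e. $\eta(A)$ is invertible; (IV) $A$ has no zero eigenvalue; more precisely, if $Ax=\lambda x$ for some commutative quaternion $\lambda\in H$ and some commutative quaternion column vector $x\neq 0$, then $\lambda\neq 0$.
   Context: The commutative quaternions are the real algebra $H=\{q=t+ix+jy+kz : t,x,y,z\in\mathbb{R}\}$ with $\mathbb{R}$-basis $1,i,j,k$ and commutative bilinear multiplication determined by $i^2=k^2=-1$, $j^2=1$, $ijk=-1$, $ij=ji=k$, $jk=kj=i$, $ki=ik=-j$. $M_n(H)$ is the set of $n\times n$ matrices with entries in $H$, with ordinary addition and multiplication; $A\in M_n(H)$ is invertible if $AB=BA=I$ for some $B\in M_n(H)$. The elements $\alpha+i\beta$ ($\alpha,\beta\in\mathbb{R}$) of $H$ form a field identified with $\mathbb{C}$; every $q=t+ix+jy+kz\in H$ is uniquely $c_1+jc_2$ with $c_1=t+ix$, $c_2=y+iz\in\mathbb{C}$, so every $A\in M_n(H)$ is uniquely $A=A_1+jA_2$ with $A_1,A_2$ complex $n\times n$ matrices. The complex adjoint matrix of $A$ is the $2n\times2n$ complex matrix $\eta(A)=\begin{pmatrix} A_1 & A_2 \\ A_2 & A_1 \end{pmatrix}$. An eigenvalue of $A$ is a $\lambda\in H$ such that $Ax=\lambda x$ for some non-zero column vector $x$ with entries in $H$. *)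

theory Defs
  imports "HOL-Analysis.Analysis"
begin

(* CQuat t x y z stands for t + i x + j y + k z. *)
datatype cquat = CQuat (cq_t: real) (cq_x: real) (cq_y: real) (cq_z: real)

lemma cquat_eq_iff:
  "p = q \<longleftrightarrow> cq_t p = cq_t q \<and> cq_x p = cq_x q \<and> cq_y p = cq_y q \<and> cq_z p = cq_z q"
  by (rule cquat.expand [THEN iffI[rotated]]) auto

instantiation cquat :: "{comm_ring_1, real_algebra_1}"
begin

definition zero_cquat :: cquat where
  "0 = CQuat 0 0 0 0"

definition one_cquat :: cquat where
  "1 = CQuat 1 0 0 0"

definition plus_cquat :: "cquat \<Rightarrow> cquat \<Rightarrow> cquat" where
  "p + q = CQuat (cq_t p + cq_t q) (cq_x p + cq_x q) (cq_y p + cq_y q) (cq_z p + cq_z q)"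

definition uminus_cquat :: "cquat \<Rightarrow> cquat" where
  "- p = CQuat (- cq_t p) (- cq_x p) (- cq_y p) (- cq_z p)"

definition minus_cquat :: "cquat \<Rightarrow> cquat \<Rightarrow> cquat" where
  "p - q = CQuat (cq_t p - cq_t q) (cq_x p - cq_x q) (cq_y p - cq_y q) (cq_z p - cq_z q)"

definition scaleR_cquat :: "real \<Rightarrow> cquat \<Rightarrow> cquat" where
  "r *\<^sub>R q = CQuat (r * cq_t q) (r * cq_x q) (r * cq_y q) (r * cq_z q)"

(* The bilinear extension of the multiplication table verified in cq_unit_mult below. *)
definition times_cquat :: "cquat \<Rightarrow> cquat \<Rightarrow> cquat" where
  "p * q = CQuat
    (cq_t p * cq_t q - cq_x p * cq_x q + cq_y p * cq_y q - cq_z p * cq_z q)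
    (cq_t p * cq_x q + cq_x p * cq_t q + cq_y p * cq_z q + cq_z p * cq_y q)
    (cq_t p * cq_y q + cq_y p * cq_t q - cq_x p * cq_z q - cq_z p * cq_x q)
    (cq_t p * cq_z q + cq_z p * cq_t q + cq_x p * cq_y q + cq_y p * cq_x q)"

instance
  by standard
    (simp_all add: cquat_eq_iff zero_cquat_def one_cquat_def plus_cquat_def uminus_cquat_def
      minus_cquat_def scaleR_cquat_def times_cquat_def algebra_simps)

end

definition cq_i :: cquat where "cq_i = CQuat 0 1 0 0"
definition cq_j :: cquat where "cq_j = CQuat 0 0 1 0"
definition cq_k :: cquat where "cq_k = CQuat 0 0 0 1"

lemma cq_unit_mult:
  "cq_i * cq_i = - 1" "cq_j * cq_j = 1" "cq_k * cq_k = - 1" "cq_i * cq_j * cq_k = - 1"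
  "cq_i * cq_j = cq_k" "cq_j * cq_i = cq_k" "cq_j * cq_k = cq_i" "cq_k * cq_j = cq_i"
  "cq_k * cq_i = - cq_j" "cq_i * cq_k = - cq_j"
  by (simp_all add: cq_i_def cq_j_def cq_k_def times_cquat_def uminus_cquat_def one_cquat_def)

lemma CQuat_eq_basis:
  "CQuat t x y z = of_real t + cq_i * of_real x + cq_j * of_real y + cq_k * of_real z"
  by (simp add: of_real_def cq_i_def cq_j_def cq_k_def times_cquat_def plus_cquat_def
      scaleR_cquat_def one_cquat_def)

definition cq_of_complex :: "complex \<Rightarrow> cquat" where
  "cq_of_complex c = CQuat (Re c) (Im c) 0 0"

lemma cq_of_complex_hom:
  "cq_of_complex 1 = 1"
  "cq_of_complex (c + d) = cq_of_complex c + cq_of_complex d"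
  "cq_of_complex (c * d) = cq_of_complex c * cq_of_complex d"
  "cq_of_complex \<i> = cq_i"
  by (simp_all add: cq_of_complex_def one_cquat_def plus_cquat_def times_cquat_def cq_i_def)

lemma inj_cq_of_complex: "inj cq_of_complex"
  by (auto simp: inj_def cq_of_complex_def complex_eq_iff)

definition cq_c1 :: "cquat \<Rightarrow> complex" where
  "cq_c1 q = Complex (cq_t q) (cq_x q)"

definition cq_c2 :: "cquat \<Rightarrow> complex" where
  "cq_c2 q = Complex (cq_y q) (cq_z q)"

lemma cq_decomp_iff:
  "q = cq_of_complex c + cq_j * cq_of_complex d \<longleftrightarrow> c = cq_c1 q \<and> d = cq_c2 q"
  by (auto simp: cquat_eq_iff complex_eq_iff cq_of_complex_def cq_c1_def cq_c2_def cq_j_def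
      plus_cquat_def times_cquat_def)

(* Rows and columns of the 2n x 2n matrix are indexed by 'n + 'n: Inl indexes the first block,
   Inr the second. *)
definition complex_adjoint :: "cquat^'n^'n \<Rightarrow> complex^('n + 'n)^('n + 'n)" where
  "complex_adjoint A = (\<chi> r s. case (r, s) of
      (Inl a, Inl b) \<Rightarrow> cq_c1 (A $ a $ b)
    | (Inl a, Inr b) \<Rightarrow> cq_c2 (A $ a $ b)
    | (Inr a, Inl b) \<Rightarrow> cq_c2 (A $ a $ b)
    | (Inr a, Inr b) \<Rightarrow> cq_c1 (A $ a $ b))"

definition cq_eigenvalue :: "cquat^'n^'n \<Rightarrow> cquat \<Rightarrow> bool" where
  "cq_eigenvalue A l \<longleftrightarrow> (\<exists>x. x \<noteq> 0 \<and> A *v x = l *s x)"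

end

theory Submission imports Defs begin

text \<open>
  Send a vector \<open>x = x\<^sub>1 + j x\<^sub>2\<close> over \<open>H\<close> to the stacked complex vector \<open>(x\<^sub>1, x\<^sub>2)\<close>. Since
  \<open>j\<^sup>2 = 1\<close> and everything commutes, \<open>A x = (A\<^sub>1 x\<^sub>1 + A\<^sub>2 x\<^sub>2) + j (A\<^sub>2 x\<^sub>1 + A\<^sub>1 x\<^sub>2)\<close>, which
  is precisely the product of the complex adjoint matrix with \<open>(x\<^sub>1, x\<^sub>2)\<close>. So stacking is a
  bijection that turns the map \<open>x \<mapsto> A x\<close> into the complex linear map given by \<open>\<eta>(A)\<close>
  (\<open>stack_mult_vec\<close>, \<open>bij_stack\<close>), and the two maps are injective, or bijective, together.

  For a complex square matrix these two properties, invertibility and a nonzero determinant all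
  coincide. The ring \<open>H\<close> has zero divisors, so injectivity and dimension arguments over fields do not apply,
  but over every commutative ring a square matrix is invertible as soon as it acts bijectively on column vectors
  (\<open>invertible_iff_bij_mult_vec\<close>). Hence a trivial kernel of \<open>A\<close> passes to \<open>\<eta>(A)\<close>,
  becomes bijectivity there, and comes back as invertibility of \<open>A\<close>. Condition (IV) says that
  \<open>0\<close> is not an eigenvalue, which is another way to say that the kernel of \<open>A\<close> is trivial.
\<close>

lemma inj_mult_vec_iff_unique_kernel:
  fixes A :: "'a::ring_1^'n^'m"
  shows "inj ((*v) A) \<longleftrightarrow> (\<exists>!x. A *v x = 0)"
proof
  assume "inj ((*v) A)"
  then show "\<exists>!x. A *v x = 0"
    by (metis injD matrix_vector_mult_0_right)
next
  assume "\<exists>!x. A *v x = 0"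
  then have ker: "x = 0" if "A *v x = 0" for x
    using that matrix_vector_mult_0_right by blast
  show "inj ((*v) A)"
  proof (rule injI)
    fix x y assume "A *v x = A *v y"
    then have "A *v (x - y) = 0"
      by (simp add: matrix_vector_mult_diff_distrib)
    then show "x = y"
      using ker by fastforce
  qed
qed

text \<open>
  Solving \<open>A b\<^sub>k = e\<^sub>k\<close> for every standard basis vector \<open>e\<^sub>k\<close> yields the columns of a right
  inverse \<open>B\<close>. It is also a left inverse, because \<open>A (B A x) = A x\<close> and \<open>A\<close> acts injectively.
  Neither step divides by a scalar.
\<close>

lemma invertible_iff_bij_mult_vec:
  fixes A :: "'a::comm_ring_1^'n^'n"
  shows "invertible A \<longleftrightarrow> bij ((*v) A)"
proof
  assume "invertible A"
  then obtain B where "A ** B = mat 1" "B ** A = mat 1"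
    by (auto simp: invertible_def)
  then show "bij ((*v) A)"
    by (intro o_bij[of "(*v) B"]) (auto simp: fun_eq_iff matrix_vector_mul_assoc)
next
  assume bij: "bij ((*v) A)"
  then have "\<forall>k. \<exists>b. A *v b = axis k 1"
    by (metis bij_pointE)
  then obtain b where b: "\<And>k. A *v b k = axis k 1"
    by metis
  define B where "B = (\<chi> r k. b k $ r)"
  have right: "A ** B = mat 1"
  proof -
    have "(A ** B) $ r $ k = (A *v b k) $ r" for r k
      by (simp add: B_def matrix_matrix_mult_def matrix_vector_mult_def)
    then show ?thesis
      by (simp add: vec_eq_iff b mat_def axis_def)
  qed
  have "(B ** A) *v x = mat 1 *v x" for x
  proof -
    have "A *v ((B ** A) *v x) = (A ** B) *v (A *v x)"
      by (simp add: matrix_vector_mul_assoc matrix_mul_assoc)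
    then have "A *v ((B ** A) *v x) = A *v x"
      by (simp add: right)
    then show ?thesis
      using bij by (simp add: bij_def inj_eq)
  qed
  then have "B ** A = mat 1"
    by (simp add: matrix_eq)
  with right show "invertible A"
    by (auto simp: invertible_def)
qed

lemma inj_mult_vec_imp_bij:
  fixes M :: "'a::field^'n^'n"
  assumes "inj ((*v) M)"
  shows "bij ((*v) M)"
  using assms
  by (metis invertible_iff_bij_mult_vec invertible_left_inverse matrix_left_invertible_injective)

definition stack :: "cquat^'n \<Rightarrow> complex^('n + 'n)" where
  "stack x = (\<chi> r. case r of Inl a \<Rightarrow> cq_c1 (x $ a) | Inr a \<Rightarrow> cq_c2 (x $ a))"

lemma bij_stack: "bij stack"
proof (rule o_bij)
  let ?unstack = "\<lambda>v. \<chi> a. CQuat (Re (v $ Inl a)) (Im (v $ Inl a)) (Re (v $ Inr a)) (Im (v $ Inr a))"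
  show "?unstack \<circ> stack = id"
    by (simp add: fun_eq_iff vec_eq_iff stack_def cq_c1_def cq_c2_def)
  show "stack \<circ> ?unstack = id"
    by (auto simp: fun_eq_iff vec_eq_iff stack_def cq_c1_def cq_c2_def split: sum.split)
qed

lemma cq_c1_sum: "cq_c1 (\<Sum>a\<in>S. f a) = (\<Sum>a\<in>S. cq_c1 (f a))"
  by (induction S rule: infinite_finite_induct)
    (auto simp: cq_c1_def zero_cquat_def plus_cquat_def complex_eq_iff)

lemma cq_c2_sum: "cq_c2 (\<Sum>a\<in>S. f a) = (\<Sum>a\<in>S. cq_c2 (f a))"
  by (induction S rule: infinite_finite_induct)
    (auto simp: cq_c2_def zero_cquat_def plus_cquat_def complex_eq_iff)

lemma cq_c1_mult: "cq_c1 (p * q) = cq_c1 p * cq_c1 q + cq_c2 p * cq_c2 q"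
  by (simp add: cq_c1_def cq_c2_def times_cquat_def complex_eq_iff)

lemma cq_c2_mult: "cq_c2 (p * q) = cq_c2 p * cq_c1 q + cq_c1 p * cq_c2 q"
  by (simp add: cq_c1_def cq_c2_def times_cquat_def complex_eq_iff)

lemma sum_UNIV_Plus:
  "(\<Sum>r\<in>(UNIV :: ('n::finite + 'm::finite) set). f r) = (\<Sum>a\<in>UNIV. f (Inl a)) + (\<Sum>a\<in>UNIV. f (Inr a))"
  by (simp add: UNIV_Plus_UNIV[symmetric] sum.Plus del: UNIV_Plus_UNIV)

text \<open>
  The block pattern of \<open>\<eta>(A)\<close> is exactly what multiplication of \<open>c\<^sub>1 + j c\<^sub>2\<close> by an entry
  of \<open>A\<close> does to the pair \<open>(c\<^sub>1, c\<^sub>2)\<close>.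
\<close>

lemma stack_mult_vec: "stack (A *v x) = complex_adjoint A *v stack x"
  by (auto simp: vec_eq_iff stack_def complex_adjoint_def matrix_vector_mult_def sum_UNIV_Plus
      cq_c1_sum cq_c2_sum cq_c1_mult cq_c2_mult sum.distrib split: sum.split)

lemma conjugate_mult_vec:
  "(*v) A = inv stack \<circ> (*v) (complex_adjoint A) \<circ> stack"
  "(*v) (complex_adjoint A) = stack \<circ> (*v) A \<circ> inv stack"
proof -
  show "(*v) A = inv stack \<circ> (*v) (complex_adjoint A) \<circ> stack"
    by (simp add: fun_eq_iff inv_f_f[OF bij_is_inj[OF bij_stack]] flip: stack_mult_vec)
  show "(*v) (complex_adjoint A) = stack \<circ> (*v) A \<circ> inv stack"
    by (simp add: fun_eq_iff stack_mult_vec surj_f_inv_f[OF bij_is_surj[OF bij_stack]])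
qed

lemma inj_mult_vec_complex_adjoint: "inj ((*v) (complex_adjoint A)) \<longleftrightarrow> inj ((*v) A)"
  by (metis conjugate_mult_vec bij_stack bij_imp_bij_inv bij_is_inj inj_compose)

lemma bij_mult_vec_complex_adjoint: "bij ((*v) (complex_adjoint A)) \<longleftrightarrow> bij ((*v) A)"
  by (metis conjugate_mult_vec bij_stack bij_imp_bij_inv bij_comp)

lemma no_zero_eigenvalue_iff_unique_kernel:
  "(\<forall>l. cq_eigenvalue A l \<longrightarrow> l \<noteq> 0) \<longleftrightarrow> (\<exists>!x. A *v x = 0)"
proof -
  have "(\<forall>l. cq_eigenvalue A l \<longrightarrow> l \<noteq> 0) \<longleftrightarrow> (\<forall>x. A *v x = 0 \<longrightarrow> x = 0)"
    unfolding cq_eigenvalue_def by (metis vector_smult_lzero)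
  also have "\<dots> \<longleftrightarrow> (\<exists>!x. A *v x = 0)"
    by (metis matrix_vector_mult_0_right)
  finally show ?thesis .
qed

theorem theorem5p4:
  fixes A :: "cquat^'n^'n"
  shows "(invertible A \<longleftrightarrow> (\<exists>!x. A *v x = 0)) \<and>
         (invertible A \<longleftrightarrow> det (complex_adjoint A) \<noteq> 0) \<and>
         (det (complex_adjoint A) \<noteq> 0 \<longleftrightarrow> invertible (complex_adjoint A)) \<and>
         (invertible A \<longleftrightarrow> (\<forall>l. cq_eigenvalue A l \<longrightarrow> l \<noteq> 0))"
proof -
  have adjoint: "invertible A \<longleftrightarrow> invertible (complex_adjoint A)"
    by (simp add: invertible_iff_bij_mult_vec bij_mult_vec_complex_adjoint)
  have "invertible (complex_adjoint A) \<longleftrightarrow> inj ((*v) (complex_adjoint A))"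
    using inj_mult_vec_imp_bij invertible_iff_bij_mult_vec bij_is_inj by metis
  then have kernel: "invertible A \<longleftrightarrow> (\<exists>!x. A *v x = 0)"
    using adjoint inj_mult_vec_complex_adjoint inj_mult_vec_iff_unique_kernel by metis
  show ?thesis
    using adjoint kernel no_zero_eigenvalue_iff_unique_kernel[of A]
      invertible_det_nz[of "complex_adjoint A"] by blast
qed

end
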